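(* Let $G$ be a connected graph. Then $i_{dR}(G)\ge i_{\{R2\}}(G)+i(G)$, and this bound is sharp.
   Context: $i(G)$ is the independent domination number: the minimum cardinality of a set that is both independent and dominating in $G$. An independent double Roman dominating function (IDRDF) on $G=(V,E)$ is a function $f:V\to\{0,1,2,3\}$ such that: every vertex $v$ with $f(v)=0$ has at least two neighbors $w$ with $f(w)=2$ or at least one neighbor $w$ with $f(w)=3$; every vertex $v$ with $f(v)=1$ has a neighbor $w$ with $f(w)\ge 2$; and $\{v: f(v)>0\}$ is independent. $i_{dR}(G)$ is the minimum weight $\sum_v f(v)$ of an IDRDF on $G$. A Roman $\{2\}$-dominating function is a function $g:V\to\{0,1,2\}$ such that every $v$ with $g(v)=0$ satisfies $\sum_{u\in N(v)}g(u)\ge 2$; it is independent if $\{v:g(v)>0\}$ is independent. $i_{\{R2\}}(G)$ is the minimum weight of an independent Roman $\{2\}$-dominating function on $G$. *)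

theory Defs
  imports "Graph_Theory.Graph_Theory"
begin

text \<open>
  A finite simple undirected graph is a \<open>pair_graph\<close>: finite, loop-free, without
  parallel arcs, and with a symmetric arc relation, so that an undirected edge
  is represented by its two opposite arcs. The empty graph is excluded
  wherever \<open>connected\<close> is assumed.
\<close>

definition neighbors :: "'a pair_pre_digraph \<Rightarrow> 'a \<Rightarrow> 'a set" where
  "neighbors G v = {w \<in> pverts G. (v, w) \<in> parcs G}"

definition independent_set :: "'a pair_pre_digraph \<Rightarrow> 'a set \<Rightarrow> bool" where
  "independent_set G S \<longleftrightarrow> S \<subseteq> pverts G \<and> (\<forall>u\<in>S. \<forall>v\<in>S. (u, v) \<notin> parcs G)"

definition dominating_set :: "'a pair_pre_digraph \<Rightarrow> 'a set \<Rightarrow> bool" where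
  "dominating_set G S \<longleftrightarrow>
     S \<subseteq> pverts G \<and> (\<forall>v\<in>pverts G - S. \<exists>w\<in>neighbors G v. w \<in> S)"

definition weight :: "'a pair_pre_digraph \<Rightarrow> ('a \<Rightarrow> nat) \<Rightarrow> nat" where
  "weight G f = (\<Sum>v\<in>pverts G. f v)"

definition double_roman_dominating ::
    "'a pair_pre_digraph \<Rightarrow> ('a \<Rightarrow> nat) \<Rightarrow> bool" where
  "double_roman_dominating G f \<longleftrightarrow>
     f ` pverts G \<subseteq> {0, 1, 2, 3} \<and>
     (\<forall>v\<in>pverts G. f v = 0 \<longrightarrow>
        card {w \<in> neighbors G v. f w = 2} \<ge> 2 \<or> (\<exists>w\<in>neighbors G v. f w = 3)) \<and>
     (\<forall>v\<in>pverts G. f v = 1 \<longrightarrow> (\<exists>w\<in>neighbors G v. f w \<ge> 2))"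

definition roman2_dominating ::
    "'a pair_pre_digraph \<Rightarrow> ('a \<Rightarrow> nat) \<Rightarrow> bool" where
  "roman2_dominating G g \<longleftrightarrow>
     g ` pverts G \<subseteq> {0, 1, 2} \<and>
     (\<forall>v\<in>pverts G. g v = 0 \<longrightarrow> (\<Sum>u\<in>neighbors G v. g u) \<ge> 2)"

definition independent_support :: "'a pair_pre_digraph \<Rightarrow> ('a \<Rightarrow> nat) \<Rightarrow> bool" where
  "independent_support G f \<longleftrightarrow> independent_set G {v \<in> pverts G. f v > 0}"

definition IDRDF :: "'a pair_pre_digraph \<Rightarrow> ('a \<Rightarrow> nat) \<Rightarrow> bool" where
  "IDRDF G f \<longleftrightarrow> double_roman_dominating G f \<and> independent_support G f"

definition IR2DF :: "'a pair_pre_digraph \<Rightarrow> ('a \<Rightarrow> nat) \<Rightarrow> bool" where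
  "IR2DF G g \<longleftrightarrow> roman2_dominating G g \<and> independent_support G g"

text \<open>
  The minima below are taken over nonempty sets for every finite graph; see
  \<open>independent_dominating_exists\<close>, \<open>IDRDF_exists\<close> and \<open>IR2DF_exists\<close>.
\<close>

definition i_dom :: "'a pair_pre_digraph \<Rightarrow> nat" where
  "i_dom G = (LEAST k. \<exists>S. independent_set G S \<and> dominating_set G S \<and> k = card S)"

definition i_dR :: "'a pair_pre_digraph \<Rightarrow> nat" where
  "i_dR G = (LEAST k. \<exists>f. IDRDF G f \<and> k = weight G f)"

definition i_R2 :: "'a pair_pre_digraph \<Rightarrow> nat" where
  "i_R2 G = (LEAST k. \<exists>g. IR2DF G g \<and> k = weight G g)"

lemma independent_dominating_exists:
  assumes "pair_graph G"
  shows "\<exists>S. independent_set G S \<and> dominating_set G S"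
proof -
  interpret pair_graph G by fact
  let ?I = "{S. independent_set G S}"
  have "?I \<subseteq> Pow (pverts G)" by (auto simp: independent_set_def)
  then have fin: "finite ?I"
    using pair_finite_verts by (meson finite_Pow_iff finite_subset)
  have "{} \<in> ?I" by (simp add: independent_set_def)
  then obtain S where S: "S \<in> ?I" and max: "\<And>T. T \<in> ?I \<Longrightarrow> S \<subseteq> T \<Longrightarrow> S = T"
    using finite_has_maximal[OF fin] by blast
  have "\<exists>w\<in>neighbors G v. w \<in> S" if v: "v \<in> pverts G - S" for v
  proof (rule ccontr)
    assume no: "\<not> ?thesis"
    have out: "(v, w) \<notin> parcs G" if "w \<in> S" for w
      using no that S by (auto simp: neighbors_def independent_set_def)
    have "(w, v) \<notin> parcs G" if "w \<in> S" for w
      using out[OF that] arcs_symmetric by blast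
    then have "insert v S \<in> ?I"
      using S v out pair_no_loops[of "(v, v)"] by (auto simp: independent_set_def)
    with max[of "insert v S"] v show False by blast
  qed
  then show ?thesis using S by (auto simp: dominating_set_def independent_set_def)
qed

lemma IDRDF_exists:
  assumes "pair_graph G"
  shows "\<exists>f. IDRDF G f"
proof -
  obtain S where S: "independent_set G S" "dominating_set G S"
    using independent_dominating_exists[OF assms] by blast
  have "{v \<in> pverts G. (if v \<in> S then 3 else 0 :: nat) > 0} = S"
    using S by (auto simp: independent_set_def)
  then have "IDRDF G (\<lambda>v. if v \<in> S then 3 else 0)"
    using S by (auto simp: IDRDF_def double_roman_dominating_def
        independent_support_def dominating_set_def)
  then show ?thesis by blast
qed

lemma IR2DF_exists:
  assumes "pair_graph G"
  shows "\<exists>g. IR2DF G g"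
proof -
  interpret pair_graph G by fact
  obtain S where S: "independent_set G S" "dominating_set G S"
    using independent_dominating_exists[OF assms] by blast
  let ?g = "\<lambda>v. if v \<in> S then 2 else 0 :: nat"
  have "{v \<in> pverts G. ?g v > 0} = S"
    using S by (auto simp: independent_set_def)
  moreover have "(\<Sum>u\<in>neighbors G v. ?g u) \<ge> 2" if v: "v \<in> pverts G - S" for v
  proof -
    obtain w where w: "w \<in> neighbors G v" "w \<in> S"
      using S v by (auto simp: dominating_set_def)
    have "finite (neighbors G v)" using pair_finite_verts by (simp add: neighbors_def)
    from member_le_sum[OF w(1) _ this, of ?g] w show ?thesis by simp
  qed
  ultimately have "IR2DF G ?g"
    using S by (auto simp: IR2DF_def roman2_dominating_def independent_support_def)
  then show ?thesis by blast
qed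

end

theory Submission
  imports Defs
begin

text \<open>
  If \<open>f\<close> is an IDRDF, then no vertex has value 1, since its neighbor of value at least 2 would
  violate independence. Hence the support \<open>S\<close> of \<open>f\<close> is an independent dominating set, and lowering
  \<open>f\<close> by one on \<open>S\<close> yields an independent Roman \<open>{2}\<close>-dominating function of weight
  \<open>weight G f - card S\<close>. Graphs with at least two vertices and a vertex adjacent to all others
  attain equality as \<open>3 = 2 + 1\<close>; complete graphs are of this kind.
\<close>

lemma i_dR_le: "IDRDF G f \<Longrightarrow> i_dR G \<le> weight G f"
  unfolding i_dR_def by (intro Least_le) blast

lemma i_R2_le: "IR2DF G g \<Longrightarrow> i_R2 G \<le> weight G g"
  unfolding i_R2_def by (intro Least_le) blast

lemma i_dom_le: "independent_set G S \<Longrightarrow> dominating_set G S \<Longrightarrow> i_dom G \<le> card S"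
  unfolding i_dom_def by (intro Least_le) blast

lemma i_dR_attained:
  assumes "pair_graph G"
  obtains f where "IDRDF G f" "weight G f = i_dR G"
proof -
  have "\<exists>f. IDRDF G f \<and> i_dR G = weight G f"
    unfolding i_dR_def by (rule LeastI_ex) (use IDRDF_exists[OF assms] in blast)
  then show thesis using that by auto
qed

lemma i_R2_attained:
  assumes "pair_graph G"
  obtains g where "IR2DF G g" "weight G g = i_R2 G"
proof -
  have "\<exists>g. IR2DF G g \<and> i_R2 G = weight G g"
    unfolding i_R2_def by (rule LeastI_ex) (use IR2DF_exists[OF assms] in blast)
  then show thesis using that by auto
qed

lemma i_dom_attained:
  assumes "pair_graph G"
  obtains S where "independent_set G S" "dominating_set G S" "card S = i_dom G"
proof -
  have "\<exists>S. independent_set G S \<and> dominating_set G S \<and> i_dom G = card S"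
    unfolding i_dom_def
    by (rule LeastI_ex) (use independent_dominating_exists[OF assms] in blast)
  then show thesis using that by auto
qed

lemma (in pair_graph) finite_neighbors: "finite (neighbors G v)"
  using pair_finite_verts by (simp add: neighbors_def)

text \<open>Excluding the value 1 ensures that lowering a function by one creates no new
  zeros.\<close>

lemma IDRDF_values:
  assumes "IDRDF G f" "v \<in> pverts G"
  shows "f v \<in> {0, 2, 3}"
proof -
  have "f v \<noteq> 1"
  proof
    assume "f v = 1"
    then obtain w where "w \<in> neighbors G v" "f w \<ge> 2"
      using assms by (auto simp: IDRDF_def double_roman_dominating_def)
    with \<open>f v = 1\<close> assms show False
      by (auto simp: IDRDF_def independent_support_def independent_set_def neighbors_def)
  qed
  moreover have "f v \<in> {0, 1, 2, 3}"
    using assms by (auto simp: IDRDF_def double_roman_dominating_def)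
  ultimately show ?thesis by blast
qed

text \<open>Either form of protection of a zero, two neighbors of value 2 or one of value 3,
  supplies a neighbor in the support.\<close>

lemma IDRDF_support_dominating:
  assumes "IDRDF G f"
  shows "dominating_set G {v \<in> pverts G. f v > 0}"
  unfolding dominating_set_def
proof (intro conjI ballI)
  fix v assume v: "v \<in> pverts G - {v \<in> pverts G. f v > 0}"
  then have "card {w \<in> neighbors G v. f w = 2} \<ge> 2 \<or> (\<exists>w\<in>neighbors G v. f w = 3)"
    using assms by (auto simp: IDRDF_def double_roman_dominating_def)
  then have "\<exists>w\<in>neighbors G v. f w > 0"
  proof
    assume "card {w \<in> neighbors G v. f w = 2} \<ge> 2"
    then have "{w \<in> neighbors G v. f w = 2} \<noteq> {}" by (metis card.empty not_numeral_le_zero)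
    then show ?thesis by force
  qed force
  then show "\<exists>w\<in>neighbors G v. w \<in> {v \<in> pverts G. f v > 0}"
    by (auto simp: neighbors_def)
qed auto

text \<open>Values 2 and 3 become 1 and 2, so two neighbors of value 2, or a single one of value 3,
  still contribute at least 2 to the sum at a zero.\<close>

lemma IDRDF_imp_IR2DF:
  assumes "pair_graph G" "IDRDF G f"
  shows "IR2DF G (\<lambda>v. f v - 1)"
proof -
  interpret pair_graph G by fact
  have "(\<Sum>u\<in>neighbors G v. f u - 1) \<ge> 2" if v: "v \<in> pverts G" "f v - 1 = 0" for v
  proof -
    \<comment> \<open>Truncated subtraction also sends 1 to 0, but \<open>f\<close> never takes the
      value 1.\<close>
    have "f v = 0" using v IDRDF_values[OF assms(2) v(1)] by auto
    then have "card {w \<in> neighbors G v. f w = 2} \<ge> 2 \<or> (\<exists>w\<in>neighbors G v. f w = 3)"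
      using assms(2) v by (auto simp: IDRDF_def double_roman_dominating_def)
    then show ?thesis
    proof
      assume "card {w \<in> neighbors G v. f w = 2} \<ge> 2"
      also have "card {w \<in> neighbors G v. f w = 2}
          = (\<Sum>u\<in>{w \<in> neighbors G v. f w = 2}. f u - 1)" by simp
      also have "\<dots> \<le> (\<Sum>u\<in>neighbors G v. f u - 1)"
        by (rule sum_mono2) (auto simp: finite_neighbors)
      finally show ?thesis .
    next
      assume "\<exists>w\<in>neighbors G v. f w = 3"
      then obtain w where w: "w \<in> neighbors G v" "f w = 3" by blast
      from member_le_sum[OF w(1) _ finite_neighbors, of "\<lambda>u. f u - 1"] w(2)
      show ?thesis by simp
    qed
  qed
  moreover have "f v - 1 \<in> {0, 1, 2}" if "v \<in> pverts G" for v
    using IDRDF_values[OF assms(2) that] by auto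
  \<comment> \<open>The support can only shrink, and subsets of independent sets are
    independent.\<close>
  moreover have "independent_support G (\<lambda>v. f v - 1)"
    using assms(2) by (auto simp: IDRDF_def independent_support_def independent_set_def)
  ultimately show ?thesis
    by (auto simp: IR2DF_def roman2_dominating_def image_subset_iff)
qed

text \<open>Each positive vertex loses exactly 1, and truncation leaves the zeros unchanged.\<close>

lemma (in pair_graph) weight_eq_weight_pred_plus_card_support:
  "weight G f = weight G (\<lambda>v. f v - 1) + card {v \<in> pverts G. f v > 0}"
proof -
  have "card {v \<in> pverts G. f v > 0} = (\<Sum>v\<in>pverts G. if f v > 0 then 1 else 0)"
    using pair_finite_verts by (simp add: sum.If_cases Int_def)
  then show ?thesis
    unfolding weight_def by (auto simp flip: sum.distrib intro!: sum.cong)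
qed

lemma i_R2_plus_i_dom_le_i_dR:
  assumes "pair_graph G"
  shows "i_R2 G + i_dom G \<le> i_dR G"
proof -
  interpret pair_graph G by fact
  \<comment> \<open>For an \<open>f\<close> of minimum weight, the lowered function and the support
    are candidates for the two minima on the left.\<close>
  obtain f where f: "IDRDF G f" "weight G f = i_dR G"
    using i_dR_attained[OF assms] .
  have "i_R2 G \<le> weight G (\<lambda>v. f v - 1)"
    by (rule i_R2_le[OF IDRDF_imp_IR2DF[OF assms f(1)]])
  moreover have "i_dom G \<le> card {v \<in> pverts G. f v > 0}"
    using f(1) by (intro i_dom_le IDRDF_support_dominating)
      (simp_all add: IDRDF_def independent_support_def)
  ultimately show ?thesis
    using f(2) weight_eq_weight_pred_plus_card_support[of f] by linarith
qed

lemma i_dom_pos: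
  assumes "pair_graph G" "pverts G \<noteq> {}"
  shows "i_dom G \<ge> 1"
proof -
  interpret pair_graph G by fact
  obtain S where S: "dominating_set G S" "card S = i_dom G"
    using i_dom_attained[OF assms(1)] by blast
  then have "finite S" using pair_finite_verts by (auto simp: dominating_set_def finite_subset)
  moreover have "S \<noteq> {}" using S assms(2) by (auto simp: dominating_set_def)
  ultimately show ?thesis using S(2) by (metis One_nat_def Suc_leI card_gt_0_iff)
qed

text \<open>A zero forces weight 2 on its neighborhood alone; without zeros, every vertex
  contributes at least 1. A single vertex of value 1 shows why two vertices are asked for.\<close>

lemma i_R2_ge_2:
  assumes "pair_graph G" "card (pverts G) \<ge> 2"
  shows "i_R2 G \<ge> 2"
proof -
  interpret pair_graph G by fact
  obtain g where g: "IR2DF G g" "weight G g = i_R2 G"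
    using i_R2_attained[OF assms(1)] .
  have "weight G g \<ge> 2"
  proof (cases "\<exists>v\<in>pverts G. g v = 0")
    case True
    then obtain v where "(\<Sum>u\<in>neighbors G v. g u) \<ge> 2"
      using g(1) by (auto simp: IR2DF_def roman2_dominating_def)
    also have "(\<Sum>u\<in>neighbors G v. g u) \<le> weight G g"
      unfolding weight_def using pair_finite_verts
      by (intro sum_mono2) (auto simp: neighbors_def)
    finally show ?thesis .
  next
    case False
    have "card (pverts G) = (\<Sum>v\<in>pverts G. 1)" by simp
    also have "\<dots> \<le> weight G g"
      unfolding weight_def using False by (intro sum_mono) (simp add: Suc_leI)
    finally show ?thesis using assms(2) by linarith
  qed
  then show ?thesis using g(2) by simp
qed

text \<open>Value 3 at \<open>c\<close> and 0 elsewhere gives \<open>i_dR G \<le> 3\<close>, while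
  the general bound gives \<open>3 \<le> i_R2 G + i_dom G \<le> i_dR G\<close>.\<close>

lemma i_dR_eq_if_universal_vertex:
  assumes "pair_graph G" "card (pverts G) \<ge> 2" "c \<in> pverts G"
    and adj: "\<And>v. v \<in> pverts G \<Longrightarrow> v \<noteq> c \<Longrightarrow> (v, c) \<in> parcs G"
  shows "i_dR G = i_R2 G + i_dom G"
proof -
  interpret pair_graph G by fact
  let ?f = "\<lambda>v. if v = c then 3 else 0 :: nat"
  have "{v \<in> pverts G. ?f v > 0} = {c}" using assms(3) by auto
  then have "IDRDF G ?f"
    \<comment> \<open>The support is the singleton of \<open>c\<close>, which is independent because
      there is no loop at \<open>c\<close>.\<close>
    using assms(3) adj pair_no_loops[of "(c, c)"]
    by (auto simp: IDRDF_def double_roman_dominating_def independent_support_def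
        independent_set_def neighbors_def)
  then have "i_dR G \<le> weight G ?f" by (rule i_dR_le)
  also have "weight G ?f = 3" using assms(3) pair_finite_verts by (simp add: weight_def)
  finally have "i_dR G \<le> 3" .
  moreover have "i_dom G \<ge> 1" using assms(1,3) by (intro i_dom_pos) auto
  ultimately show ?thesis
    using i_R2_ge_2[OF assms(1,2)] i_R2_plus_i_dom_le_i_dR[OF assms(1)] by linarith
qed

definition complete_pair_graph :: "'a set \<Rightarrow> 'a pair_pre_digraph" where
  "complete_pair_graph V = \<lparr>pverts = V, parcs = {(u, v). u \<in> V \<and> v \<in> V \<and> u \<noteq> v}\<rparr>"

lemma pair_graph_complete:
  assumes "finite V"
  shows "pair_graph (complete_pair_graph V)"
proof
  show "finite (parcs (complete_pair_graph V))"
    by (rule finite_subset[of _ "V \<times> V"]) (auto simp: complete_pair_graph_def assms)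
  show "symmetric (with_proj (complete_pair_graph V))"
    by (auto simp: symmetric_def complete_pair_graph_def intro: symI)
qed (auto simp: complete_pair_graph_def assms)

text \<open>Distinct vertices are joined by a path of length one.\<close>

lemma connected_complete:
  assumes "V \<noteq> {}"
  shows "Digraph_Component.connected (with_proj (complete_pair_graph V))"
proof -
  have "(u, v) \<in> rtrancl_on V (symcl (parcs (complete_pair_graph V)))"
    if "u \<in> V" "v \<in> V" for u v
  proof (cases "u = v")
    case False
    then have "(u, v) \<in> symcl (parcs (complete_pair_graph V))"
      using that by (simp add: symcl_def complete_pair_graph_def)
    with that show ?thesis by (meson rtrancl_on_refl rtrancl_on_into_rtrancl_on)
  qed (use that in simp)
  then show ?thesis
    unfolding connected_conv using assms by (simp add: complete_pair_graph_def)
qed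

theorem theorem8:
  shows "(\<forall>G :: 'a pair_pre_digraph.
            pair_graph G \<and> Digraph_Component.connected (with_proj G) \<longrightarrow>
              i_dR G \<ge> i_R2 G + i_dom G) \<and>
         (\<forall>n. \<exists>H :: nat pair_pre_digraph.
            pair_graph H \<and> Digraph_Component.connected (with_proj H) \<and>
              card (pverts H) \<ge> n \<and> i_dR H = i_R2 H + i_dom H)"
proof (intro conjI allI impI)
  fix G :: "'a pair_pre_digraph"
  assume "pair_graph G \<and> Digraph_Component.connected (with_proj G)"
  then show "i_dR G \<ge> i_R2 G + i_dom G" using i_R2_plus_i_dom_le_i_dR by blast
next
  fix n :: nat
  \<comment> \<open>The offset 2 guarantees two vertices even for \<open>n = 0\<close>, as the lower
    bound 2 on \<open>i_R2\<close> requires; any vertex, here 0, is universal.\<close>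
  let ?H = "complete_pair_graph {..<n + 2}"
  have "pair_graph ?H" by (rule pair_graph_complete) simp
  moreover have "Digraph_Component.connected (with_proj ?H)"
    by (rule connected_complete) (simp add: lessThan_empty_iff)
  moreover have "card (pverts ?H) \<ge> n" by (simp add: complete_pair_graph_def)
  moreover have "i_dR ?H = i_R2 ?H + i_dom ?H"
    using \<open>pair_graph ?H\<close>
    by (rule i_dR_eq_if_universal_vertex[where c = 0]) (auto simp: complete_pair_graph_def)
  ultimately show "\<exists>H :: nat pair_pre_digraph.
      pair_graph H \<and> Digraph_Component.connected (with_proj H) \<and>
        card (pverts H) \<ge> n \<and> i_dR H = i_R2 H + i_dom H" by blast
qed

end
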